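(* Let $f:\mathbb{R}^n\to\mathbb{R}$ be of class $C^2$, convex, $L$-smooth and bounded below, with $f^\star:=\inf f$ and $\phi(x_1):=f(x_1)-f^\star$. Consider the system $\dot x_1=x_2$, $\dot x_2=u$ with $x_1,x_2,u\in\mathbb{R}^n$. Let $\alpha:\mathbb{R}^n\to\mathbb{R}^n$ be continuously differentiable and put $e:=x_2-\alpha(x_1)$. Assume that there exist a continuously differentiable $V_1:\mathbb{R}^n\to\mathbb{R}$ and constants $c_\phi,\sigma,\lambda>0$ such that $V_1(x_1)\ge c_\phi\phi(x_1)$ for all $x_1$, and such that along $\dot x_1=\alpha(x_1)+e$ one has $\dot V_1=-\sigma\|\nabla f(x_1)\|^2+\lambda\nabla f(x_1)^\top e$, i.e. for all $(x_1,e)$ $$\nabla V_1(x_1)^\top(\alpha(x_1)+e)=-\sigma\|\nabla f(x_1)\|^2+\lambda\nabla f(x_1)^\top e.$$ Assume in addition that boundedness of $\nabla f(x_1)$ implies boundedness of $\alpha(x_1)$; that is, for every $R>0$, $\alpha$ is bounded on $\{x_1:\|\nabla f(x_1)\|\le R\}$. Let $c>0$ and choose $$u=\dot\alpha-c\,e-\lambda\nabla f(x_1),\qquad \dot\alpha=\frac{\partial\alpha}{\partial x_1}(x_1)\,x_2 .$$ Then, with $V:=V_1(x_1)+\frac12\|e\|^2$, the closed-loop system satisfies $$\dot V=-\sigma\|\nabla f(x_1)\|^2-c\|e\|^2,$$ and consequently, along every closed-loop trajectory on $[0,\infty)$, $\nabla f(x_1(t))\to0$ as $t\to\infty$.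
   Context: $\|\cdot\|$ is the Euclidean norm. $L$-smooth means $\|\nabla f(x)-\nabla f(y)\|\le L\|x-y\|$ for all $x,y\in\mathbb{R}^n$. $\dot V$ denotes the time derivative along trajectories. *)

theory Defs
  imports "HOL-Analysis.Analysis"
begin

definition grad :: "('a::real_inner \<Rightarrow> real) \<Rightarrow> 'a \<Rightarrow> 'a" where
  "grad f x = (THE D. GDERIV f x :> D)"

lemma GDERIV_grad_eq:
  assumes "GDERIV f x :> D"
  shows "grad f x = D"
proof -
  have "E = D" if "GDERIV f x :> E" for E
  proof -
    have "(\<lambda>h. inner h E) = (\<lambda>h. inner h D)"
      using that assms unfolding gderiv_def by (rule has_derivative_unique)
    then have "inner (E - D) E = inner (E - D) D"
      by metis
    then show ?thesis
      by (metis inner_diff_right inner_eq_zero_iff eq_iff_diff_eq_0)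
  qed
  with assms show ?thesis
    unfolding grad_def by blast
qed

lemma GDERIV_grad:
  fixes f :: "'a::euclidean_space \<Rightarrow> real"
  assumes "f differentiable (at x)"
  shows "GDERIV f x :> grad f x"
proof -
  obtain f' where f': "(f has_derivative f') (at x)"
    using assms by (auto simp: differentiable_def)
  then have lin: "linear f'"
    by (rule has_derivative_linear)
  define D where "D = (\<Sum>b\<in>Basis. f' b *\<^sub>R b)"
  have "f' h = inner h D" for h
  proof -
    have "f' h = f' (\<Sum>b\<in>Basis. inner h b *\<^sub>R b)"
      by (simp add: euclidean_representation)
    also have "\<dots> = inner h D"
      unfolding D_def
      by (simp add: linear_sum[OF lin] linear_cmul[OF lin] inner_sum_right mult.commute)
    finally show ?thesis .
  qed
  then have "f' = (\<lambda>h. inner h D)" ..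
  with f' have "GDERIV f x :> D"
    by (simp add: gderiv_def)
  then show ?thesis
    using GDERIV_grad_eq by metis
qed

definition C1_map :: "('a::real_normed_vector \<Rightarrow> 'b::real_normed_vector) \<Rightarrow> bool" where
  "C1_map f \<longleftrightarrow>
    (\<exists>f' :: 'a \<Rightarrow> 'a \<Rightarrow>\<^sub>L 'b. (\<forall>x. (f has_derivative blinfun_apply (f' x)) (at x)) \<and> continuous_on UNIV f')"

definition C2_map :: "('a::real_normed_vector \<Rightarrow> 'b::real_normed_vector) \<Rightarrow> bool" where
  "C2_map f \<longleftrightarrow>
    (\<exists>f' :: 'a \<Rightarrow> 'a \<Rightarrow>\<^sub>L 'b. (\<forall>x. (f has_derivative blinfun_apply (f' x)) (at x)) \<and> C1_map f')"

definition L_smooth :: "real \<Rightarrow> ('a::real_inner \<Rightarrow> real) \<Rightarrow> bool" where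
  "L_smooth L f \<longleftrightarrow> (\<forall>x y. norm (grad f x - grad f y) \<le> L * norm (x - y))"

text \<open>Classical solutions of \<open>x1' = x2\<close>, \<open>x2' = u\<close> on a set \<open>J\<close> of times; derivatives are
  one-sided at endpoints belonging to \<open>J\<close>.\<close>

definition double_integrator_on ::
    "real set \<Rightarrow> (real \<Rightarrow> 'a::real_normed_vector) \<Rightarrow> (real \<Rightarrow> 'a) \<Rightarrow> (real \<Rightarrow> 'a) \<Rightarrow> bool" where
  "double_integrator_on J u x1 x2 \<longleftrightarrow>
    (\<forall>t\<in>J. (x1 has_vector_derivative x2 t) (at t within J) \<and>
            (x2 has_vector_derivative u t) (at t within J))"

definition err :: "('a::real_inner \<Rightarrow> 'a) \<Rightarrow> 'a \<Rightarrow> 'a \<Rightarrow> 'a" where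
  "err \<alpha> x1 x2 = x2 - \<alpha> x1"

text \<open>The first summand is the time derivative of \<open>\<alpha> (x1 t)\<close> along \<open>x1' = x2\<close>, by the chain rule.\<close>

definition feedback ::
    "('a::real_inner \<Rightarrow> real) \<Rightarrow> ('a \<Rightarrow> 'a) \<Rightarrow> real \<Rightarrow> real \<Rightarrow> 'a \<Rightarrow> 'a \<Rightarrow> 'a" where
  "feedback f \<alpha> c lam x1 x2 =
    frechet_derivative \<alpha> (at x1) x2 - c *\<^sub>R err \<alpha> x1 x2 - lam *\<^sub>R grad f x1"

definition closed_loop_on ::
    "real set \<Rightarrow> ('a::real_inner \<Rightarrow> real) \<Rightarrow> ('a \<Rightarrow> 'a) \<Rightarrow> real \<Rightarrow> real \<Rightarrow>
      (real \<Rightarrow> 'a) \<Rightarrow> (real \<Rightarrow> 'a) \<Rightarrow> bool" where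
  "closed_loop_on J f \<alpha> c lam x1 x2 \<longleftrightarrow>
    double_integrator_on J (\<lambda>t. feedback f \<alpha> c lam (x1 t) (x2 t)) x1 x2"

definition lyap :: "('a::real_inner \<Rightarrow> real) \<Rightarrow> ('a \<Rightarrow> 'a) \<Rightarrow> 'a \<times> 'a \<Rightarrow> real" where
  "lyap V1 \<alpha> = (\<lambda>(x1, x2). V1 x1 + 1 / 2 * (norm (err \<alpha> x1 x2))\<^sup>2)"

end

theory Submission
  imports Defs
begin

text \<open>
  Write \<open>e = x2 - \<alpha> x1\<close>, \<open>g = grad f x1\<close> and \<open>V = V1 x1 + (norm e)\<^sup>2 / 2\<close>. The feedback is chosen so that
  \<open>e' = - c e - lam g\<close>: it cancels the drift of \<open>\<alpha>\<close>, adds damping, and its last term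
  contributes \<open>- lam (g \<bullet> e)\<close> to the derivative of \<open>(norm e)\<^sup>2 / 2\<close>. This is exactly the
  opposite of the cross term that the mismatch \<open>e\<close> produces in the derivative of \<open>V1\<close>, so that
  \<open>V' = - \<sigma> (norm g)\<^sup>2 - c (norm e)\<^sup>2\<close>.

  For the convergence, \<open>V\<close> is nonincreasing along a trajectory and is the sum of two nonnegative
  terms, the first of which dominates a positive multiple of \<open>f x1 - inf f\<close>; so both \<open>f x1\<close>
  and \<open>e\<close> stay bounded. A smooth function that is bounded below
  controls its own gradient (\<open>norm_grad_squared_le\<close>), so \<open>g\<close> is bounded as well, hence so is
  \<open>\<alpha> x1\<close>, and therefore so is the velocity \<open>x2 = e + \<alpha> x1\<close>. The position
  \<open>x1\<close> may still escape to infinity, but a bounded velocity makes it Lipschitz in time, and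
  \<open>L\<close>-smoothness transfers this to \<open>g\<close>. Since \<open>V\<close> is bounded below and loses at least
  \<open>\<sigma> (norm g)\<^sup>2\<close> per unit of time, a Barbalat-type argument
  (\<open>tendsto_zero_of_dissipation\<close>) yields \<open>g \<longlonglongrightarrow> 0\<close>.
\<close>

section \<open>Gradients of smooth functions\<close>

lemma C1_map_imp_differentiable: "C1_map f \<Longrightarrow> f differentiable (at x)"
  unfolding C1_map_def differentiable_def by blast

lemma C2_map_imp_differentiable: "C2_map f \<Longrightarrow> f differentiable (at x)"
  unfolding C2_map_def differentiable_def by blast

lemma L_smooth_mono:
  assumes "L_smooth L f" and "L \<le> K"
  shows "L_smooth K f"
  unfolding L_smooth_def
  by (meson L_smooth_def assms mult_right_mono norm_ge_zero order_trans)

text \<open>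
  One gradient step of length \<open>1 / L\<close> lowers \<open>f\<close> by at least \<open>(norm (grad f x))\<^sup>2 / (2 * L)\<close>,
  and it cannot go below the infimum.
\<close>

lemma norm_grad_squared_le:
  fixes f :: "'a::euclidean_space \<Rightarrow> real"
  assumes diff: "\<And>x. f differentiable (at x)"
    and smooth: "L_smooth L f" and "L > 0" and bdd: "bdd_below (range f)"
  shows "(norm (grad f x))\<^sup>2 \<le> 2 * L * (f x - (INF y. f y))"
proof -
  define g where "g = grad f x"
  \<comment> \<open>Along the ray from \<open>x\<close> in direction \<open>- g\<close>, the difference between \<open>f\<close> and the
    variable part of its quadratic upper bound at \<open>x\<close>.\<close>
  define h where "h s = f (x - s *\<^sub>R g) + s * (norm g)\<^sup>2 - L / 2 * s\<^sup>2 * (norm g)\<^sup>2" for s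
  have h_deriv: "(h has_real_derivative
      - (g \<bullet> grad f (x - s *\<^sub>R g)) + (norm g)\<^sup>2 - L * s * (norm g)\<^sup>2) (at s)" for s
  proof -
    have "(f has_derivative (\<lambda>v. v \<bullet> grad f (x - s *\<^sub>R g))) (at (x - s *\<^sub>R g))"
      using GDERIV_grad[OF diff] by (simp add: gderiv_def)
    moreover have "((\<lambda>s. x - s *\<^sub>R g) has_derivative (\<lambda>r. - (r *\<^sub>R g))) (at s)"
      by (auto intro!: derivative_eq_intros)
    ultimately have "((\<lambda>s. f (x - s *\<^sub>R g)) has_derivative
        (\<lambda>r. - (r *\<^sub>R g) \<bullet> grad f (x - s *\<^sub>R g))) (at s)"
      by (rule has_derivative_compose[rotated])
    then have "((\<lambda>s. f (x - s *\<^sub>R g)) has_real_derivative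
        - (g \<bullet> grad f (x - s *\<^sub>R g))) (at s)"
      by (rule has_derivative_imp_has_field_derivative) (simp add: mult.commute)
    then show ?thesis
      unfolding h_def by (auto intro!: derivative_eq_intros)
  qed
  have "h (1 / L) \<le> h 0"
  proof (rule DERIV_nonpos_imp_nonincreasing[where f = h])
    fix s :: real
    assume s: "0 \<le> s" "s \<le> 1 / L"
    have "g \<bullet> (g - grad f (x - s *\<^sub>R g)) \<le> norm g * norm (g - grad f (x - s *\<^sub>R g))"
      by (rule norm_cauchy_schwarz)
    also have "\<dots> \<le> norm g * (L * norm (x - (x - s *\<^sub>R g)))"
      using smooth unfolding L_smooth_def g_def by (intro mult_left_mono) (blast, simp)
    also have "\<dots> = L * s * (norm g)\<^sup>2"
      using s by (simp add: power2_eq_square)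
    finally have "- (g \<bullet> grad f (x - s *\<^sub>R g)) + (norm g)\<^sup>2 - L * s * (norm g)\<^sup>2 \<le> 0"
      by (simp add: inner_diff_right power2_norm_eq_inner)
    with h_deriv show "\<exists>y. (h has_real_derivative y) (at s) \<and> y \<le> 0"
      by blast
  qed (use \<open>L > 0\<close> in simp)
  moreover have "h (1 / L) = f (x - (1 / L) *\<^sub>R g) + (norm g)\<^sup>2 / (2 * L)"
    using \<open>L > 0\<close> by (simp add: h_def power2_eq_square field_simps)
  moreover have "h 0 = f x"
    by (simp add: h_def)
  ultimately have "(norm g)\<^sup>2 / (2 * L) \<le> f x - f (x - (1 / L) *\<^sub>R g)"
    by linarith
  also have "\<dots> \<le> f x - (INF y. f y)"
    using cINF_lower[OF bdd, of "x - (1 / L) *\<^sub>R g"] by simp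
  finally show ?thesis
    using \<open>L > 0\<close> by (simp add: g_def field_simps)
qed

section \<open>Dissipation and convergence on the half-line\<close>

lemma mvt_half_line:
  fixes W :: "real \<Rightarrow> real"
  assumes deriv: "\<And>t. t \<ge> 0 \<Longrightarrow> (W has_real_derivative W' t) (at t within {0..})"
    and "0 \<le> a" "a < b"
  shows "\<exists>s. a < s \<and> s < b \<and> W b - W a = W' s * (b - a)"
proof -
  have "(W has_derivative (*) (W' s)) (at s within {a..b})" if "a \<le> s" "s \<le> b" for s
    using deriv[of s] that \<open>0 \<le> a\<close>
    by (auto simp: has_field_derivative_def intro: has_derivative_subset)
  from mvt_simple[OF \<open>a < b\<close> this] show ?thesis
    by auto
qed

lemma nonincreasing_of_nonpos_derivative:
  fixes W :: "real \<Rightarrow> real"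
  assumes deriv: "\<And>t. t \<ge> 0 \<Longrightarrow> (W has_real_derivative W' t) (at t within {0..})"
    and "\<And>t. t \<ge> 0 \<Longrightarrow> W' t \<le> 0" and "0 \<le> a" "a \<le> b"
  shows "W b \<le> W a"
proof (cases "a = b")
  case False
  with assms obtain s where "a < s" "W b - W a = W' s * (b - a)"
    using mvt_half_line[OF deriv, of a b] by auto
  then show ?thesis
    using assms(2)[of s] assms(3,4) by (smt (verit) mult_nonpos_nonneg)
qed simp

text \<open>
  A Lipschitz \<open>g\<close> that is larger than \<open>\<epsilon>\<close> at time \<open>t\<close> stays above \<open>\<epsilon> / 2\<close> for a time \<open>\<delta>\<close>
  which does not depend on \<open>t\<close>, so \<open>W\<close> drops by a fixed amount after \<open>t\<close>. Once \<open>W\<close> is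
  closer to its infimum than this amount, that cannot happen any more.
\<close>

lemma tendsto_zero_of_dissipation:
  fixes W :: "real \<Rightarrow> real" and g :: "real \<Rightarrow> 'a::real_normed_vector"
  assumes deriv: "\<And>t. t \<ge> 0 \<Longrightarrow> (W has_real_derivative W' t) (at t within {0..})"
    and dissip: "\<And>t. t \<ge> 0 \<Longrightarrow> W' t \<le> - \<sigma> * (norm (g t))\<^sup>2"
    and "\<sigma> > 0"
    and bdd: "bdd_below (W ` {0..})"
    and lip: "K-lipschitz_on {0..} g"
  shows "(g \<longlongrightarrow> 0) at_top"
proof -
  note mvt = mvt_half_line[OF deriv]
  have W'_nonpos: "W' t \<le> 0" if "t \<ge> 0" for t
    using dissip[OF that] \<open>\<sigma> > 0\<close> by (smt (verit) mult_nonneg_nonneg zero_le_power2 minus_mult_left)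
  note W_antimono = nonincreasing_of_nonpos_derivative[OF deriv W'_nonpos]
  have "K \<ge> 0"
    using lip by (rule lipschitz_on_nonneg)
  have "\<forall>\<^sub>F t in at_top. norm (g t) < \<epsilon>" if "\<epsilon> > 0" for \<epsilon>
  proof -
    define \<delta> where "\<delta> = \<epsilon> / (2 * (K + 1))"
    define drop where "drop = \<sigma> * (\<epsilon> / 2)\<^sup>2 * \<delta>"
    have "\<delta> > 0"
      using \<open>\<epsilon> > 0\<close> \<open>K \<ge> 0\<close> by (simp add: \<delta>_def)
    then have "drop > 0"
      using \<open>\<epsilon> > 0\<close> \<open>\<sigma> > 0\<close> by (simp add: drop_def)
    have K\<delta>: "K * \<delta> \<le> \<epsilon> / 2"
      using \<open>\<epsilon> > 0\<close> \<open>K \<ge> 0\<close> by (simp add: \<delta>_def field_simps)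
    have "\<exists>T\<in>{0..}. W T < (INF t\<in>{0..}. W t) + drop"
      using \<open>drop > 0\<close> cINF_less_iff[OF _ bdd, of "(INF t\<in>{0..}. W t) + drop"] by auto
    then obtain T where T: "T \<ge> 0" "W T < (INF t\<in>{0..}. W t) + drop"
      by auto
    have "norm (g t) < \<epsilon>" if "t \<ge> T" for t
    proof (rule ccontr)
      assume "\<not> norm (g t) < \<epsilon>"
      then have big: "norm (g t) \<ge> \<epsilon>"
        by simp
      obtain s where s: "t < s" "s < t + \<delta>" "W (t + \<delta>) - W t = W' s * \<delta>"
        using mvt[of t "t + \<delta>"] \<open>\<delta> > 0\<close> T \<open>t \<ge> T\<close> by auto
      have "norm (g t) - norm (g s) \<le> dist (g t) (g s)"
        by (simp add: dist_norm norm_triangle_ineq2)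
      also have "\<dots> \<le> K * dist t s"
        using s T that by (intro lipschitz_onD[OF lip]) auto
      also have "\<dots> \<le> K * \<delta>"
        using s \<open>K \<ge> 0\<close> by (intro mult_left_mono) (auto simp: dist_real_def)
      finally have "norm (g s) \<ge> \<epsilon> / 2"
        using big K\<delta> by linarith
      then have "\<sigma> * (\<epsilon> / 2)\<^sup>2 \<le> \<sigma> * (norm (g s))\<^sup>2"
        using \<open>\<epsilon> > 0\<close> \<open>\<sigma> > 0\<close> by (intro mult_left_mono power_mono) auto
      then have "W' s \<le> - (\<sigma> * (\<epsilon> / 2)\<^sup>2)"
        using dissip[of s] s T that by simp
      then have "W' s * \<delta> \<le> - drop"
        unfolding drop_def using \<open>\<delta> > 0\<close> by (metis less_imp_le minus_mult_left mult_right_mono)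
      moreover have "W t \<le> W T"
        using W_antimono T that by simp
      moreover have "(INF t\<in>{0..}. W t) \<le> W (t + \<delta>)"
        using T that \<open>\<delta> > 0\<close> by (intro cINF_lower[OF bdd]) simp
      ultimately show False
        using s T by linarith
    qed
    then show ?thesis
      using eventually_at_top_linorder by blast
  qed
  then show ?thesis
    by (simp add: tendsto_iff dist_norm)
qed

lemma has_vector_derivative_bounded_imp_lipschitz:
  fixes x :: "real \<Rightarrow> 'a::real_normed_vector"
  assumes "\<And>t. t \<in> S \<Longrightarrow> (x has_vector_derivative v t) (at t within S)"
    and "convex S" and "\<And>t. t \<in> S \<Longrightarrow> norm (v t) \<le> M" and "M \<ge> 0"
  shows "M-lipschitz_on S x"
proof (rule bounded_derivative_imp_lipschitz)
  show "(x has_derivative (\<lambda>r. r *\<^sub>R v t)) (at t within S)" if "t \<in> S" for t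
    using assms(1)[OF that] by (simp add: has_vector_derivative_def)
  show "onorm (\<lambda>r. r *\<^sub>R v t) \<le> M" if "t \<in> S" for t
    using assms(3)[OF that] by (intro onorm_le) (simp add: mult.commute[of M] mult_left_mono)
qed (use assms in auto)

section \<open>The Lyapunov function along the feedback\<close>

lemma has_derivative_lyap:
  fixes V1 :: "'a::euclidean_space \<Rightarrow> real"
  assumes V1: "V1 differentiable (at x1)" and \<alpha>: "\<alpha> differentiable (at x1)"
  shows "(lyap V1 \<alpha> has_derivative (\<lambda>(h1, h2).
      grad V1 x1 \<bullet> h1 + err \<alpha> x1 x2 \<bullet> (h2 - frechet_derivative \<alpha> (at x1) h1))) (at (x1, x2))"
proof -
  have fst_deriv: "(fst has_derivative fst) (at (x1, x2))"
    by (rule has_derivative_fst[OF has_derivative_ident])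
  have "(V1 has_derivative (\<lambda>h. h \<bullet> grad V1 x1)) (at (fst (x1, x2)))"
    using GDERIV_grad[OF V1] by (simp add: gderiv_def)
  from has_derivative_compose[OF fst_deriv this]
  have dV1: "((\<lambda>p. V1 (fst p)) has_derivative (\<lambda>h. fst h \<bullet> grad V1 x1)) (at (x1, x2))" .
  have "(\<alpha> has_derivative frechet_derivative \<alpha> (at x1)) (at (fst (x1, x2)))"
    using \<alpha> by (simp add: frechet_derivative_works)
  from has_derivative_compose[OF fst_deriv this]
  have d\<alpha>: "((\<lambda>p. \<alpha> (fst p)) has_derivative (\<lambda>h. frechet_derivative \<alpha> (at x1) (fst h)))
      (at (x1, x2))" .
  have lyap_eq: "lyap V1 \<alpha> = (\<lambda>p. V1 (fst p) +
      1 / 2 * ((snd p - \<alpha> (fst p)) \<bullet> (snd p - \<alpha> (fst p))))"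
    by (auto simp: lyap_def err_def power2_norm_eq_inner)
  show ?thesis
    unfolding lyap_eq
    by (auto intro!: derivative_eq_intros dV1 d\<alpha>
        simp: fun_eq_iff err_def inner_commute algebra_simps)
qed

text \<open>
  The gradient of \<open>V1\<close> is paired with the velocity \<open>\<alpha> x1 + err \<alpha> x1 x2\<close>, which is \<open>x2\<close>; the
  cross term \<open>lam * (grad f x1 \<bullet> err \<alpha> x1 x2)\<close> in the hypothesis is cancelled by the feedback.
\<close>

lemma lyap_decay_along_feedback:
  assumes "grad V1 x1 \<bullet> (\<alpha> x1 + err \<alpha> x1 x2)
      = - \<sigma> * (norm (grad f x1))\<^sup>2 + lam * (grad f x1 \<bullet> err \<alpha> x1 x2)"
  shows "grad V1 x1 \<bullet> x2
      + err \<alpha> x1 x2 \<bullet> (feedback f \<alpha> c lam x1 x2 - frechet_derivative \<alpha> (at x1) x2)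
    = - \<sigma> * (norm (grad f x1))\<^sup>2 - c * (norm (err \<alpha> x1 x2))\<^sup>2"
proof -
  have "\<alpha> x1 + err \<alpha> x1 x2 = x2"
    by (simp add: err_def)
  with assms show ?thesis
    by (simp add: feedback_def inner_diff_right power2_norm_eq_inner inner_commute)
qed

section \<open>Convergence of the gradient in closed loop\<close>

theorem corollary1:
  fixes f V1 :: "real ^ 'n \<Rightarrow> real"
    and \<alpha> :: "real ^ 'n \<Rightarrow> real ^ 'n"
    and L c_\<phi> \<sigma> lam c :: real
  assumes "C2_map f" and "convex_on UNIV f" and "L_smooth L f" and "bdd_below (range f)"
    and "C1_map \<alpha>"
    and "C1_map V1"
    and "c_\<phi> > 0" and "\<sigma> > 0" and "lam > 0"
    and "\<And>x1. V1 x1 \<ge> c_\<phi> * (f x1 - (INF y. f y))"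
    and "\<And>x1 e. grad V1 x1 \<bullet> (\<alpha> x1 + e) = - \<sigma> * (norm (grad f x1))\<^sup>2 + lam * (grad f x1 \<bullet> e)"
    and "\<And>R. R > 0 \<Longrightarrow> bounded (\<alpha> ` {x1. norm (grad f x1) \<le> R})"
    and "c > 0"
  shows
    "(\<forall>x1 x2. lyap V1 \<alpha> differentiable (at (x1, x2)) \<and>
        frechet_derivative (lyap V1 \<alpha>) (at (x1, x2)) (x2, feedback f \<alpha> c lam x1 x2)
          = - \<sigma> * (norm (grad f x1))\<^sup>2 - c * (norm (err \<alpha> x1 x2))\<^sup>2) \<and>
     (\<forall>J x1 x2. is_interval J \<and> closed_loop_on J f \<alpha> c lam x1 x2 \<longrightarrow>
        (\<forall>t\<in>J. ((\<lambda>s. lyap V1 \<alpha> (x1 s, x2 s)) has_real_derivative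
            - \<sigma> * (norm (grad f (x1 t)))\<^sup>2 - c * (norm (err \<alpha> (x1 t) (x2 t)))\<^sup>2) (at t within J))) \<and>
     (\<forall>x1 x2. closed_loop_on {0..} f \<alpha> c lam x1 x2 \<longrightarrow>
        ((\<lambda>t. grad f (x1 t)) \<longlongrightarrow> 0) at_top)"
proof -
  note \<alpha>_diff = C1_map_imp_differentiable[OF \<open>C1_map \<alpha>\<close>]
    and V1_diff = C1_map_imp_differentiable[OF \<open>C1_map V1\<close>]
    and f_diff = C2_map_imp_differentiable[OF \<open>C2_map f\<close>]
  note V1_ge = assms(10) and V1_rate = assms(11) and \<alpha>_bdd = assms(12)
  note lyap_deriv = has_derivative_lyap[OF V1_diff \<alpha>_diff]
  note decay = lyap_decay_along_feedback[where \<alpha> = \<alpha>, OF V1_rate]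
  let ?W' = "\<lambda>x1 x2. - \<sigma> * (norm (grad f x1))\<^sup>2 - c * (norm (err \<alpha> x1 x2))\<^sup>2"

  have pointwise: "lyap V1 \<alpha> differentiable (at (x1, x2)) \<and>
      frechet_derivative (lyap V1 \<alpha>) (at (x1, x2)) (x2, feedback f \<alpha> c lam x1 x2) = ?W' x1 x2"
    for x1 x2
    using lyap_deriv[of x1 x2] decay[of x1 x2]
    by (auto simp: differentiable_def frechet_derivative_at[symmetric])

  have along: "((\<lambda>s. lyap V1 \<alpha> (x1 s, x2 s)) has_real_derivative ?W' (x1 t) (x2 t))
      (at t within J)"
    if "closed_loop_on J f \<alpha> c lam x1 x2" "t \<in> J" for J x1 x2 t
  proof -
    have x12: "((\<lambda>s. (x1 s, x2 s)) has_vector_derivative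
        (x2 t, feedback f \<alpha> c lam (x1 t) (x2 t))) (at t within J)"
      using that unfolding closed_loop_on_def double_integrator_on_def
      by (intro has_vector_derivative_Pair) auto
    have "((\<lambda>s. lyap V1 \<alpha> (x1 s, x2 s)) has_vector_derivative ?W' (x1 t) (x2 t))
        (at t within J)"
      using vector_derivative_diff_chain_within[OF x12
          has_derivative_at_withinI[OF lyap_deriv[of "x1 t" "x2 t"]]] decay[of "x1 t" "x2 t"]
      by (simp add: o_def)
    then show ?thesis
      by (simp add: has_real_derivative_iff_has_vector_derivative)
  qed

  have "((\<lambda>t. grad f (x1 t)) \<longlongrightarrow> 0) at_top"
    if cl: "closed_loop_on {0..} f \<alpha> c lam x1 x2" for x1 x2
  proof -
    define W where "W t = lyap V1 \<alpha> (x1 t, x2 t)" for t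
    have W_eq: "W t = V1 (x1 t) + (norm (err \<alpha> (x1 t) (x2 t)))\<^sup>2 / 2" for t
      by (simp add: W_def lyap_def)
    have W_deriv: "(W has_real_derivative ?W' (x1 t) (x2 t)) (at t within {0..})"
      if "t \<ge> 0" for t
      using along[OF cl, of t] that unfolding W_def by simp
    have W_rate: "?W' (x1 t) (x2 t) \<le> - \<sigma> * (norm (grad f (x1 t)))\<^sup>2" for t
      using \<open>c > 0\<close> by simp
    have W_le: "W t \<le> W 0" if "t \<ge> 0" for t
      by (rule nonincreasing_of_nonpos_derivative[OF W_deriv])
        (use that \<open>c > 0\<close> \<open>\<sigma> > 0\<close> in
          \<open>auto intro: order_trans[OF _ mult_nonneg_nonneg]\<close>)
    \<comment> \<open>The Lipschitz constant may be enlarged, so it can be taken positive.\<close>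
    define K where "K = max L 1"
    have "K > 0" and smooth: "L_smooth K f"
      using L_smooth_mono[OF \<open>L_smooth L f\<close>, of K] by (auto simp: K_def)
    have f_ge: "(INF y. f y) \<le> f x" for x
      using \<open>bdd_below (range f)\<close> by (intro cINF_lower) auto
    have V1_nonneg: "V1 x \<ge> 0" for x
      using V1_ge[of x] f_ge[of x] \<open>c_\<phi> > 0\<close>
      by (meson diff_ge_0_iff_ge less_imp_le mult_nonneg_nonneg order_trans)
    have W_bdd: "bdd_below (W ` {0..})"
      by (rule bdd_belowI2[of _ 0]) (simp add: W_eq V1_nonneg)

    \<comment> \<open>The summand \<open>1\<close> keeps the radius positive even when \<open>W 0 = 0\<close>.\<close>
    define R where "R = sqrt (2 * K * (W 0 / c_\<phi>)) + 1"
    have "W 0 \<ge> 0"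
      by (simp add: W_eq V1_nonneg)
    have "R > 0"
      using \<open>W 0 \<ge> 0\<close> \<open>K > 0\<close> \<open>c_\<phi> > 0\<close> by (simp add: R_def add_nonneg_pos)
    have grad_bdd: "norm (grad f (x1 t)) \<le> R" if "t \<ge> 0" for t
    proof -
      have "c_\<phi> * (f (x1 t) - (INF y. f y)) \<le> W 0"
        using V1_ge[of "x1 t"] W_le[OF that]
          zero_le_power2[of "norm (err \<alpha> (x1 t) (x2 t))"]
        unfolding W_eq[of t] by linarith
      then have "f (x1 t) - (INF y. f y) \<le> W 0 / c_\<phi>"
        using \<open>c_\<phi> > 0\<close> by (simp add: field_simps)
      then have "2 * K * (f (x1 t) - (INF y. f y)) \<le> 2 * K * (W 0 / c_\<phi>)"
        using \<open>K > 0\<close> by (intro mult_left_mono) auto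
      with norm_grad_squared_le[OF f_diff smooth \<open>K > 0\<close> \<open>bdd_below (range f)\<close>, of "x1 t"]
      have "(norm (grad f (x1 t)))\<^sup>2 \<le> 2 * K * (W 0 / c_\<phi>)"
        by linarith
      then have "norm (grad f (x1 t)) \<le> sqrt (2 * K * (W 0 / c_\<phi>))"
        by (rule real_le_rsqrt)
      then show ?thesis
        by (simp add: R_def)
    qed
    obtain B where B: "B > 0" "\<And>x. norm (grad f x) \<le> R \<Longrightarrow> norm (\<alpha> x) \<le> B"
      using \<alpha>_bdd[OF \<open>R > 0\<close>] unfolding bounded_pos by auto
    define M where "M = sqrt (2 * W 0) + B"
    have "M \<ge> 0"
      using \<open>W 0 \<ge> 0\<close> B by (simp add: M_def)
    have x2_bdd: "norm (x2 t) \<le> M" if "t \<ge> 0" for t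
    proof -
      have "(norm (err \<alpha> (x1 t) (x2 t)))\<^sup>2 \<le> 2 * W 0"
        using W_le[OF that] V1_nonneg[of "x1 t"] by (simp add: W_eq[of t])
      then have "norm (err \<alpha> (x1 t) (x2 t)) \<le> sqrt (2 * W 0)"
        by (rule real_le_rsqrt)
      moreover have "norm (\<alpha> (x1 t)) \<le> B"
        using B grad_bdd that by simp
      moreover have "x2 t = err \<alpha> (x1 t) (x2 t) + \<alpha> (x1 t)"
        by (simp add: err_def)
      ultimately show ?thesis
        unfolding M_def by (smt (verit) norm_triangle_ineq)
    qed
    have "M-lipschitz_on {0..} x1"
      using cl x2_bdd \<open>M \<ge> 0\<close> unfolding closed_loop_on_def double_integrator_on_def
      by (intro has_vector_derivative_bounded_imp_lipschitz[where v = x2]) auto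
    moreover have "K-lipschitz_on (x1 ` {0..}) (grad f)"
      using smooth \<open>K > 0\<close> by (auto simp: lipschitz_on_def L_smooth_def dist_norm)
    ultimately have lip: "(K * M)-lipschitz_on {0..} (\<lambda>t. grad f (x1 t))"
      by (rule lipschitz_on_compose2)
    show ?thesis
      by (rule tendsto_zero_of_dissipation[OF W_deriv W_rate \<open>\<sigma> > 0\<close> W_bdd lip])
  qed
  with pointwise along show ?thesis
    by blast
qed

end
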